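(* (i) Let $q,t,s_1,s_2$ be independent indeterminates. As formal power series in $x_2/x_1$, $$(1-x_2/x_1)\sum_{\theta=0}^\infty c_2(\theta;s_1,s_2,q,t)\,(x_2/x_1)^\theta=\sum_{\theta=0}^\infty t^{\theta}\,\frac{(t^{-1};q)_{\theta}}{(q;q)_{\theta}}\,\frac{(t^{-1}s_1/s_2;q)_{\theta}}{(qs_1/s_2;q)_{\theta}}\,\frac{1-q^{2\theta}t^{-1}s_1/s_2}{1-t^{-1}s_1/s_2}\,(x_2/x_1)^\theta .$$ (ii) Let $\lambda=(\lambda_1,\lambda_2)$ be a partition and set $s_1=t\,q^{\lambda_1}$, $s_2=q^{\lambda_2}$. Then, as formal power series in the raising operator $R_{12}$, $$\sum_{\theta=0}^\infty C^{(q,t)}_{\theta}(q^{\lambda_1-\lambda_2})\,R_{12}^{\theta}=(1-R_{12})\sum_{\theta=0}^\infty c_2(\theta;s_1,s_2,q,t)\,R_{12}^{\theta}.$$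
   Context: Notation: $(a;q)_m=(1-a)(1-aq)\cdots(1-aq^{m-1})$ for integers $m\ge 0$. For integers $\theta\ge0$, $$c_2(\theta;s_1,s_2,q,t)=t^{\theta}\,\frac{(qt^{-1};q)_{\theta}}{(q;q)_{\theta}}\,\frac{(qt^{-1}s_1/s_2;q)_{\theta}}{(qs_1/s_2;q)_{\theta}} .$$ For an indeterminate $u$ and an integer $\theta\ge 0$, with $v=q^\theta u$, the Lassalle–Schlosser function in one variable is the rational function $$C^{(q,t)}_{\theta}(u)=t^{\theta}\,\frac{(q/t;q)_{\theta}}{(q;q)_{\theta}}\,\frac{(qu;q)_{\theta}}{(qtu;q)_{\theta}}\left(1-\frac{1-tv}{1-v}\cdot\frac{u-v}{tu-v}\right).$$ It is formed as a rational function of the indeterminate $u$ and then evaluated at the given value of $u$ (in particular $C^{(q,t)}_0(u)=1$). The raising operator $R_{12}$ acts on integer sequences by $R_{12}(a_1,a_2)=(a_1+1,a_2-1)$; here it may be treated as a formal variable. *)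

theory Defs
  imports "HOL-Computational_Algebra.Computational_Algebra"
begin

definition qpoch :: "'a::comm_ring_1 \<Rightarrow> 'a \<Rightarrow> nat \<Rightarrow> 'a" where
  "qpoch a q m = (\<Prod>i<m. 1 - a * q ^ i)"

definition c2 :: "nat \<Rightarrow> 'a::field \<Rightarrow> 'a \<Rightarrow> 'a \<Rightarrow> 'a \<Rightarrow> 'a" where
  "c2 \<theta> s\<^sub>1 s\<^sub>2 q t =
     t ^ \<theta> * (qpoch (q * inverse t) q \<theta> / qpoch q q \<theta>)
           * (qpoch (q * inverse t * s\<^sub>1 / s\<^sub>2) q \<theta> / qpoch (q * s\<^sub>1 / s\<^sub>2) q \<theta>)"

text \<open>Elements of \<open>'a poly fract\<close> are rational functions of one indeterminate over the field
  \<open>'a\<close>. The value of such a function at a point is computed from any representation whose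
  denominator does not vanish there; it is unspecified at a pole.\<close>

definition ratfun_eval :: "'a::field poly fract \<Rightarrow> 'a \<Rightarrow> 'a" where
  "ratfun_eval f a =
     (THE c. \<exists>n d. f = Fract n d \<and> poly d a \<noteq> 0 \<and> c = poly n a / poly d a)"

lemma ratfun_eval_Fract:
  assumes "poly d a \<noteq> 0"
  shows "ratfun_eval (Fract n d) a = poly n a / poly d a"
  unfolding ratfun_eval_def
proof (rule the_equality)
  show "\<exists>n' d'. Fract n d = Fract n' d' \<and> poly d' a \<noteq> 0 \<and> poly n a / poly d a = poly n' a / poly d' a"
    using assms by blast
next
  fix c
  assume "\<exists>n' d'. Fract n d = Fract n' d' \<and> poly d' a \<noteq> 0 \<and> c = poly n' a / poly d' a"
  then obtain n' d' where *: "Fract n d = Fract n' d'" "poly d' a \<noteq> 0" "c = poly n' a / poly d' a"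
    by blast
  from assms * have "d \<noteq> 0" "d' \<noteq> 0" by auto
  with *(1) have "n * d' = n' * d" by (simp add: eq_fract)
  hence "poly n a * poly d' a = poly n' a * poly d a" by (metis poly_mult)
  with assms *(2) have "poly n a / poly d a = poly n' a / poly d' a" by (simp add: frac_eq_eq)
  with *(3) show "c = poly n a / poly d a" by simp
qed

text \<open>The one-variable Lassalle--Schlosser function, as a rational function of the
  indeterminate \<open>u\<close>; \<open>Q\<close> and \<open>T\<close> are the constants \<open>q\<close> and \<open>t\<close>. Evaluation at a point is a
  separate step because the formula can be of the form 0/0 there (\<open>\<theta> = 0\<close>, \<open>u = 1\<close>).\<close>

definition LS_fun :: "'a::field \<Rightarrow> 'a \<Rightarrow> nat \<Rightarrow> 'a poly fract" where
  "LS_fun q t \<theta> =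
     (let u = to_fract [:0, 1:]; Q = to_fract [:q:]; T = to_fract [:t:]; v = Q ^ \<theta> * u
      in T ^ \<theta> * (qpoch (Q / T) Q \<theta> / qpoch Q Q \<theta>)
               * (qpoch (Q * u) Q \<theta> / qpoch (Q * T * u) Q \<theta>)
               * (1 - (1 - T * v) / (1 - v) * ((u - v) / (T * u - v))))"

definition LS :: "'a::field \<Rightarrow> 'a \<Rightarrow> nat \<Rightarrow> 'a \<Rightarrow> 'a" where
  "LS q t \<theta> a = ratfun_eval (LS_fun q t \<theta>) a"

text \<open>The field \<open>k(q, t, s\<^sub>1, s\<^sub>2)\<close> of rational functions in four independent indeterminates, as the
  fraction field of \<open>k[q][t][s\<^sub>1][s\<^sub>2]\<close>.\<close>

type_synonym 'k ratfun4 = "'k poly poly poly poly fract"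

definition indet_q :: "'k::field_char_0 ratfun4" where
  "indet_q = to_fract [:[:[:[:0, 1:]:]:]:]"

definition indet_t :: "'k::field_char_0 ratfun4" where
  "indet_t = to_fract [:[:[:0, 1:]:]:]"

definition indet_s1 :: "'k::field_char_0 ratfun4" where
  "indet_s1 = to_fract [:[:0, 1:]:]"

definition indet_s2 :: "'k::field_char_0 ratfun4" where
  "indet_s2 = to_fract [:0, 1:]"

end

theory Submission
  imports Defs
begin

text \<open>With \<open>z = q ^ (\<theta> + 1)\<close> and \<open>w = s\<^sub>1 / s\<^sub>2\<close>, the difference of consecutive coefficients
  \<open>c2 (\<theta> + 1) - c2 \<theta>\<close> factors because
  \<open>t (1 - z / t) (1 - z w / t) - (1 - z) (1 - z w) = (t - 1) (1 - z\<^sup>2 w / t)\<close>.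
  On the other side, the bracket in the Lassalle--Schlosser function factors because
  \<open>(1 - v) (t u - v) - (1 - t v) (u - v) = (t - 1) (u - v\<^sup>2)\<close>; for \<open>w = t u\<close> the two closed
  forms coincide, and after cancellation neither has a pole at \<open>u = q ^ m\<close>.\<close>

section \<open>Shifted factorials and multiplication by \<open>1 - fps_X\<close>\<close>

lemma qpoch_0 [simp]: "qpoch a q 0 = 1"
  by (simp add: qpoch_def)

lemma qpoch_Suc: "qpoch a q (Suc n) = qpoch a q n * (1 - a * q ^ n)"
  by (simp add: qpoch_def)

lemma qpoch_Suc': "qpoch a q (Suc n) = (1 - a) * qpoch (q * a) q n"
  unfolding qpoch_def
  by (subst prod.lessThan_Suc_shift) (simp add: mult_ac)

lemma qpoch_nonzero:
  fixes a q :: "'a::field"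
  assumes "\<And>i. a * q ^ i \<noteq> 1"
  shows "qpoch a q n \<noteq> 0"
  using assms by (simp add: qpoch_def)

lemma fps_one_minus_X_mult_nth:
  fixes f :: "nat \<Rightarrow> 'a::comm_ring_1"
  shows "fps_nth ((1 - fps_X) * Abs_fps f) n = (if n = 0 then f 0 else f n - f (n - 1))"
  by (simp add: left_diff_distrib)

section \<open>Consecutive differences of \<open>c2\<close>\<close>

lemma c2_0 [simp]: "c2 0 s\<^sub>1 s\<^sub>2 q t = 1"
  by (simp add: c2_def)

text \<open>The ratio \<open>w\<close> is kept as a separate variable so that one formula serves
  both for independent \<open>s\<^sub>1\<close>, \<open>s\<^sub>2\<close> and for the specialisation
  \<open>w = t * a\<close>.\<close>

lemma c2_Suc_diff:
  fixes q t w :: "'a::field"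
  assumes w: "s\<^sub>1 / s\<^sub>2 = w" and t: "t \<noteq> 0"
    and q: "\<And>k. q * q ^ k \<noteq> 1" and qw: "\<And>k. q * w * q ^ k \<noteq> 1"
  shows "c2 (Suc n) s\<^sub>1 s\<^sub>2 q t - c2 n s\<^sub>1 s\<^sub>2 q t =
    t ^ n * (t - 1) * (qpoch (q / t) q n * qpoch (q * (w / t)) q n * (1 - q ^ (2 * Suc n) * (w / t)))
      / (qpoch q q (Suc n) * qpoch (q * w) q (Suc n))"
proof -
  define A where "A = qpoch (q / t) q n"
  define B where "B = qpoch (q * (w / t)) q n"
  define C where "C = qpoch q q n"
  define D where "D = qpoch (q * w) q n"
  define z where "z = q * q ^ n"
  have nz: "C \<noteq> 0" "D \<noteq> 0" "1 - z \<noteq> 0" "1 - z * w \<noteq> 0"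
    using qpoch_nonzero[of q q n] qpoch_nonzero[of "q * w" q n] q[of n] qw[of n] q qw
    by (auto simp: C_def D_def z_def mult_ac)
  have e: "q * inverse t = q / t" "q / t * s\<^sub>1 / s\<^sub>2 = q * (w / t)" "q * s\<^sub>1 / s\<^sub>2 = q * w"
    using w by (auto simp: field_simps)
  have s: "qpoch (q / t) q (Suc n) = A * (1 - z / t)"
    "qpoch (q * (w / t)) q (Suc n) = B * (1 - z * w / t)"
    "qpoch q q (Suc n) = C * (1 - z)" "qpoch (q * w) q (Suc n) = D * (1 - z * w)"
    by (simp_all add: qpoch_Suc A_def B_def C_def D_def z_def mult_ac)
  have z2: "q ^ (2 * Suc n) = z ^ 2"
    by (simp add: z_def power_mult_distrib power_mult[symmetric] power_add[symmetric] mult.commute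
        flip: power_Suc)
  have key: "t * (1 - z / t) * (1 - z * w / t) - (1 - z) * (1 - z * w) = (t - 1) * (1 - z\<^sup>2 * (w / t))"
    using t by (simp add: field_simps power2_eq_square)
  have "c2 (Suc n) s\<^sub>1 s\<^sub>2 q t - c2 n s\<^sub>1 s\<^sub>2 q t =
      t ^ n * A * B * (t * (1 - z / t) * (1 - z * w / t)) / (C * (1 - z) * (D * (1 - z * w)))
      - t ^ n * A * B / (C * D)"
    unfolding c2_def e s A_def[symmetric] B_def[symmetric] C_def[symmetric] D_def[symmetric]
    by (simp add: mult_ac)
  \<comment> \<open>The earlier coefficient is expanded to the denominator of the later one, so that
    the numerators differ by the left side of \<open>key\<close> times a common factor.\<close>
  also have "t ^ n * A * B / (C * D) =
      t ^ n * A * B * ((1 - z) * (1 - z * w)) / (C * (1 - z) * (D * (1 - z * w)))"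
    using nz by (simp add: frac_eq_eq mult_ac)
  also have "t ^ n * A * B * (t * (1 - z / t) * (1 - z * w / t)) / (C * (1 - z) * (D * (1 - z * w)))
      - t ^ n * A * B * ((1 - z) * (1 - z * w)) / (C * (1 - z) * (D * (1 - z * w))) =
      t ^ n * A * B * ((t - 1) * (1 - z\<^sup>2 * (w / t))) / (C * (1 - z) * (D * (1 - z * w)))"
    unfolding key[symmetric] by (simp add: diff_divide_distrib right_diff_distrib)
  finally show ?thesis
    unfolding s z2 A_def[symmetric] B_def[symmetric] by (simp add: mult_ac)
qed

text \<open>Compared with the difference formula, the upper symbols start one factor earlier. The
  extra \<open>1 - 1 / t\<close> combines with one power of \<open>t\<close> to
  \<open>t - 1\<close>; the extra \<open>1 - w / t\<close> cancels the denominator of the last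
  factor, and \<open>w \<noteq> t\<close> makes this cancellation legitimate.\<close>

lemma one_minus_X_mult_c2_series:
  fixes q t w :: "'a::field"
  assumes w: "s\<^sub>1 / s\<^sub>2 = w" and t: "t \<noteq> 0" and wt: "w \<noteq> t"
    and q: "\<And>k. q * q ^ k \<noteq> 1" and qw: "\<And>k. q * w * q ^ k \<noteq> 1"
  shows "(1 - fps_X) * Abs_fps (\<lambda>\<theta>. c2 \<theta> s\<^sub>1 s\<^sub>2 q t) =
    Abs_fps (\<lambda>\<theta>. t ^ \<theta> * (qpoch (inverse t) q \<theta> / qpoch q q \<theta>)
      * (qpoch (inverse t * s\<^sub>1 / s\<^sub>2) q \<theta> / qpoch (q * s\<^sub>1 / s\<^sub>2) q \<theta>)
      * ((1 - q ^ (2 * \<theta>) * inverse t * s\<^sub>1 / s\<^sub>2) / (1 - inverse t * s\<^sub>1 / s\<^sub>2)))"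
proof (rule fps_ext)
  fix n
  have nz: "1 - w / t \<noteq> 0"
    using wt t by (simp add: field_simps)
  have e: "inverse t = 1 / t" "1 / t * s\<^sub>1 / s\<^sub>2 = w / t" "q * s\<^sub>1 / s\<^sub>2 = q * w"
    "q ^ (2 * n) * (1 / t) * s\<^sub>1 / s\<^sub>2 = q ^ (2 * n) * (w / t)" for n
    using w by (auto simp: field_simps)
  show "fps_nth ((1 - fps_X) * Abs_fps (\<lambda>\<theta>. c2 \<theta> s\<^sub>1 s\<^sub>2 q t)) n =
    fps_nth (Abs_fps (\<lambda>\<theta>. t ^ \<theta> * (qpoch (inverse t) q \<theta> / qpoch q q \<theta>)
      * (qpoch (inverse t * s\<^sub>1 / s\<^sub>2) q \<theta> / qpoch (q * s\<^sub>1 / s\<^sub>2) q \<theta>)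
      * ((1 - q ^ (2 * \<theta>) * inverse t * s\<^sub>1 / s\<^sub>2) / (1 - inverse t * s\<^sub>1 / s\<^sub>2)))) n"
  proof (cases n)
    case 0
    then show ?thesis
      using nz unfolding fps_one_minus_X_mult_nth fps_nth_Abs_fps e by simp
  next
    case (Suc m)
    have t1: "t * (1 - 1 / t) = t - 1"
      using t by (simp add: field_simps)
    \<comment> \<open>The first factor of each upper symbol is split off, which shifts the remaining
      symbols to bases \<open>q / t\<close> and \<open>q * (w / t)\<close>.\<close>
    have "t ^ n * (qpoch (1 / t) q n / qpoch q q n) * (qpoch (w / t) q n / qpoch (q * w) q n)
        * ((1 - q ^ (2 * n) * (w / t)) / (1 - w / t)) =
      t ^ m * (t * (1 - 1 / t)) * (qpoch (q / t) q m * qpoch (q * (w / t)) q m * (1 - q ^ (2 * n) * (w / t)))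
      / (qpoch q q n * qpoch (q * w) q n) * ((1 - w / t) / (1 - w / t))"
      using qpoch_Suc'[of "1 / t" q m] qpoch_Suc'[of "w / t" q m] Suc by (simp add: mult_ac)
    also have "\<dots> = c2 n s\<^sub>1 s\<^sub>2 q t - c2 m s\<^sub>1 s\<^sub>2 q t"
      unfolding t1 Suc c2_Suc_diff[OF w t q qw] divide_self[OF nz] by (rule mult_1_right)
    finally show ?thesis
      unfolding fps_one_minus_X_mult_nth fps_nth_Abs_fps e using Suc by simp
  qed
qed

section \<open>The one-variable Lassalle--Schlosser function\<close>

lemma Lassalle_Schlosser_closed_form:
  fixes q t u :: "'a::field"
  assumes t: "t \<noteq> 0" and u: "u \<noteq> 0" and tq: "t \<noteq> q ^ Suc n" and uq: "q ^ Suc n * u \<noteq> 1"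
  shows "t ^ Suc n * (qpoch (q / t) q (Suc n) / qpoch q q (Suc n))
      * (qpoch (q * u) q (Suc n) / qpoch (q * t * u) q (Suc n))
      * (1 - (1 - t * (q ^ Suc n * u)) / (1 - q ^ Suc n * u)
           * ((u - q ^ Suc n * u) / (t * u - q ^ Suc n * u))) =
    t ^ n * (t - 1) * (qpoch (q / t) q n * qpoch (q * u) q n * (1 - q ^ (2 * Suc n) * u))
      / (qpoch q q (Suc n) * qpoch (q * t * u) q (Suc n))"
proof -
  \<comment> \<open>In terms of \<open>z\<close> the variable \<open>v\<close> is
    \<open>z * u\<close>; both \<open>t * u - v\<close> and the numerator of the bracket contain a
    factor \<open>u\<close>, which cancels below.\<close>
  define z where "z = q ^ Suc n"
  have nz: "t - z \<noteq> 0" "1 - z * u \<noteq> 0" "t * u - z * u \<noteq> 0"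
    using tq uq u by (auto simp: z_def)
  have z2: "q ^ (2 * Suc n) = z ^ 2"
    by (simp only: z_def mult.commute[of 2] power_mult)
  have "1 - (1 - t * (z * u)) / (1 - z * u) * ((u - z * u) / (t * u - z * u)) =
      ((1 - z * u) * (t * u - z * u) - (1 - t * (z * u)) * (u - z * u))
        / ((1 - z * u) * (t * u - z * u))"
    using nz by (metis (no_types) diff_divide_distrib divide_self mult_eq_0_iff times_divide_times_eq)
  also have "(1 - z * u) * (t * u - z * u) - (1 - t * (z * u)) * (u - z * u) =
      u * ((t - 1) * (1 - z\<^sup>2 * u))"
    by (simp add: algebra_simps power2_eq_square)
  also have "(1 - z * u) * (t * u - z * u) = u * ((1 - z * u) * (t - z))"
    by (simp add: algebra_simps)
  also have "u * ((t - 1) * (1 - z\<^sup>2 * u)) / (u * ((1 - z * u) * (t - z))) =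
      (t - 1) * (1 - z\<^sup>2 * u) / ((1 - z * u) * (t - z))"
    using u by simp
  finally have br: "1 - (1 - t * (z * u)) / (1 - z * u) * ((u - z * u) / (t * u - z * u)) =
      (t - 1) * (1 - z\<^sup>2 * u) / ((1 - z * u) * (t - z))" .
  \<comment> \<open>The last factors of the two upper symbols, one of them multiplied by
    \<open>t\<close>, are exactly the denominators \<open>t - z\<close> and \<open>1 - z * u\<close>
    left in the bracket.\<close>
  have s: "t ^ Suc n * qpoch (q / t) q (Suc n) = t ^ n * qpoch (q / t) q n * (t - z)"
    "qpoch (q * u) q (Suc n) = qpoch (q * u) q n * (1 - z * u)"
    using t by (simp_all add: qpoch_Suc z_def field_simps)
  define A where "A = qpoch (q / t) q n"
  define B where "B = qpoch (q * u) q n"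
  define C where "C = qpoch q q (Suc n)"
  define D where "D = qpoch (q * t * u) q (Suc n)"
  have "t ^ Suc n * (qpoch (q / t) q (Suc n) / C) * (qpoch (q * u) q (Suc n) / D)
      * ((t - 1) * (1 - z\<^sup>2 * u) / ((1 - z * u) * (t - z))) =
     (t ^ Suc n * qpoch (q / t) q (Suc n)) * qpoch (q * u) q (Suc n) / (C * D)
      * ((t - 1) * (1 - z\<^sup>2 * u) / ((1 - z * u) * (t - z)))"
    by simp
  also have "\<dots> = t ^ n * (t - 1) * (A * B * (1 - z\<^sup>2 * u)) / (C * D)
      * (((1 - z * u) * (t - z)) / ((1 - z * u) * (t - z)))"
    unfolding s A_def[symmetric] B_def[symmetric] by (simp add: mult_ac)
  also have "\<dots> = t ^ n * (t - 1) * (A * B * (1 - z\<^sup>2 * u)) / (C * D)"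
    using nz by simp
  finally show ?thesis
    unfolding z_def[symmetric] br z2 A_def[symmetric] B_def[symmetric] C_def[symmetric]
      D_def[symmetric] .
qed

lemma to_fract_power: "to_fract (p ^ n) = to_fract p ^ n"
  by (induction n) simp_all

text \<open>Embedding into the fraction field and evaluation at a point are ring homomorphisms,
  hence respect shifted factorials; this carries the closed form from rational functions to
  values.\<close>

lemma to_fract_qpoch: "to_fract (qpoch a q n) = qpoch (to_fract a) (to_fract q) n"
  by (induction n) (simp_all add: qpoch_Suc to_fract_power)

lemma poly_qpoch: "poly (qpoch a q n) x = qpoch (poly a x) (poly q x) n"
  by (induction n) (simp_all add: qpoch_Suc)

text \<open>For \<theta> = 0 one has \<open>v = u\<close>, so the bracket is 1 identically in
  \<open>u\<close>. Cancelling before evaluation also settles \<open>a = 1\<close>, where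
  substitution gives 0/0.\<close>

lemma LS_0:
  fixes q t :: "'a::field"
  assumes "t \<noteq> 1"
  shows "LS q t 0 a = 1"
proof -
  have "LS_fun q t 0 = Fract 1 1"
    by (simp add: LS_fun_def Let_def flip: One_fract_def)
  then show ?thesis
    by (simp add: LS_def ratfun_eval_Fract)
qed

text \<open>The closed form is applied at the indeterminate \<open>u\<close>, not at
  \<open>a\<close>. It yields a quotient of polynomials whose denominator does not vanish at
  \<open>a\<close>, so it may be evaluated there.\<close>

lemma LS_Suc:
  fixes q t a :: "'a::field"
  assumes t: "t \<noteq> 0" and tq: "t \<noteq> q ^ Suc n"
    and q: "\<And>k. q * q ^ k \<noteq> 1" and qta: "\<And>k. q * t * a * q ^ k \<noteq> 1"
  shows "LS q t (Suc n) a =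
    t ^ n * (t - 1) * (qpoch (q / t) q n * qpoch (q * a) q n * (1 - q ^ (2 * Suc n) * a))
      / (qpoch q q (Suc n) * qpoch (q * t * a) q (Suc n))"
proof -
  let ?F = "to_fract :: 'a poly \<Rightarrow> 'a poly fract"
  define u where "u = ?F [:0, 1:]"
  define Q where "Q = ?F [:q:]"
  define T where "T = ?F [:t:]"
  define N where "N = [:t:] ^ n * ([:t:] - 1) *
    (qpoch [:q / t:] [:q:] n * qpoch ([:q:] * [:0, 1:]) [:q:] n * (1 - [:q:] ^ (2 * Suc n) * [:0, 1:]))"
  define D where "D = qpoch [:q:] [:q:] (Suc n) * qpoch ([:q:] * [:t:] * [:0, 1:]) [:q:] (Suc n)"
  have T: "T \<noteq> 0" and u: "u \<noteq> 0"
    using t by (simp_all add: T_def u_def)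
  have "[:t:] \<noteq> [:q:] ^ Suc n"
    using tq unfolding poly_const_pow by simp
  then have TQ: "T \<noteq> Q ^ Suc n"
    unfolding T_def Q_def to_fract_power[symmetric] to_fract_eq_iff .
  \<comment> \<open>The left side has constant coefficient 0.\<close>
  have "[:q:] ^ Suc n * [:0, 1:] \<noteq> 1"
    unfolding poly_const_pow by (simp add: one_pCons)
  then have uQ: "Q ^ Suc n * u \<noteq> 1"
    unfolding u_def Q_def to_fract_power[symmetric] to_fract_mult[symmetric] to_fract_1[symmetric]
      to_fract_eq_iff .
  \<comment> \<open>The quotient \<open>Q / T\<close> is itself a constant polynomial, so
    \<open>N\<close> needs no denominator of its own.\<close>
  have "Q = ?F ([:q / t:] * [:t:])"
    using t by (simp add: Q_def)
  then have QT: "Q / T = ?F [:q / t:]"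
    using T unfolding to_fract_mult T_def[symmetric] by (simp add: field_simps)
  have "LS_fun q t (Suc n) =
    T ^ n * (T - 1) * (qpoch (Q / T) Q n * qpoch (Q * u) Q n * (1 - Q ^ (2 * Suc n) * u))
      / (qpoch Q Q (Suc n) * qpoch (Q * T * u) Q (Suc n))"
    unfolding LS_fun_def Let_def u_def[symmetric] Q_def[symmetric] T_def[symmetric]
    by (rule Lassalle_Schlosser_closed_form[OF T u TQ uQ])
  also have "\<dots> = ?F N / ?F D"
    unfolding N_def D_def QT
    by (simp only: to_fract_mult to_fract_diff to_fract_power to_fract_qpoch to_fract_1
        u_def Q_def T_def)
  finally have "LS_fun q t (Suc n) = Fract N D"
    by (simp add: Fract_conv_to_fract)
  moreover have D: "poly D a = qpoch q q (Suc n) * qpoch (q * t * a) q (Suc n)"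
    by (simp add: D_def poly_qpoch del: mult_pCons_left mult_pCons_right)
  moreover have "poly N a =
    t ^ n * (t - 1) * (qpoch (q / t) q n * qpoch (q * a) q n * (1 - q ^ (2 * Suc n) * a))"
    by (simp add: N_def poly_qpoch del: mult_pCons_left mult_pCons_right power_Suc)
  moreover have "poly D a \<noteq> 0"
    unfolding D using qpoch_nonzero[of q q "Suc n"] qpoch_nonzero[of "q * t * a" q "Suc n"] q qta
    by simp
  ultimately show ?thesis
    by (simp add: LS_def ratfun_eval_Fract)
qed

lemma LS_series_eq:
  fixes q t a :: "'a::field"
  assumes w: "s\<^sub>1 / s\<^sub>2 = t * a" and t: "t \<noteq> 0" and tq: "\<And>n. t \<noteq> q ^ n"
    and q: "\<And>k. q * q ^ k \<noteq> 1" and qta: "\<And>k. q * t * a * q ^ k \<noteq> 1"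
  shows "Abs_fps (\<lambda>\<theta>. LS q t \<theta> a) = (1 - fps_X) * Abs_fps (\<lambda>\<theta>. c2 \<theta> s\<^sub>1 s\<^sub>2 q t)"
proof (rule fps_ext)
  fix n
  have qw: "q * (t * a) * q ^ k \<noteq> 1" for k
    using qta[of k] by (simp add: mult_ac)
  show "fps_nth (Abs_fps (\<lambda>\<theta>. LS q t \<theta> a)) n =
    fps_nth ((1 - fps_X) * Abs_fps (\<lambda>\<theta>. c2 \<theta> s\<^sub>1 s\<^sub>2 q t)) n"
  proof (cases n)
    case 0
    then show ?thesis
      using LS_0[of t] tq[of 0] by (simp add: fps_one_minus_X_mult_nth)
  next
    case (Suc m)
    have "LS q t (Suc m) a = c2 (Suc m) s\<^sub>1 s\<^sub>2 q t - c2 m s\<^sub>1 s\<^sub>2 q t"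
      unfolding c2_Suc_diff[OF w t q qw] LS_Suc[OF t tq q qta]
      using t by (simp add: mult.assoc)
    then show ?thesis
      unfolding fps_one_minus_X_mult_nth fps_nth_Abs_fps using Suc by simp
  qed
qed

section \<open>Independence of the four indeterminates\<close>

lemma X_power_neq_1: "[:0, 1:] ^ Suc n \<noteq> (1 :: 'a::idom poly)"
proof
  assume "[:0, 1:] ^ Suc n = (1 :: 'a poly)"
  then have "poly ([:0, 1:] ^ Suc n) (0::'a) = 1"
    by simp
  then show False
    by simp
qed

lemma indet_q_neq_0: "indet_q \<noteq> (0 :: 'k::field_char_0 ratfun4)"
  and indet_t_neq_0: "indet_t \<noteq> (0 :: 'k ratfun4)"
  and indet_s2_neq_0: "indet_s2 \<noteq> (0 :: 'k ratfun4)"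
  by (simp_all add: indet_q_def indet_t_def indet_s2_def)

text \<open>As \<open>indet_q\<close> lives in the innermost polynomial layer, its powers are
  constant in the other three indeterminates. The inequalities below then follow by comparing
  coefficients in nested polynomials.\<close>

lemma indet_q_power:
  "(indet_q :: 'k::field_char_0 ratfun4) ^ n = to_fract [:[:[:[:0, 1:] ^ n:]:]:]"
  by (simp add: indet_q_def poly_const_pow flip: to_fract_power)

lemma indet_q_power_neq_1: "indet_q * indet_q ^ n \<noteq> (1 :: 'k::field_char_0 ratfun4)"
proof -
  have "to_fract [:[:[:[:0, 1:] ^ Suc n:]:]:] \<noteq> (1 :: 'k ratfun4)"
    using X_power_neq_1[where ?'a = 'k, of n]
    unfolding to_fract_1[symmetric] to_fract_eq_iff by (simp add: one_pCons del: power_Suc)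
  then show ?thesis
    using indet_q_power[where ?'k = 'k, of "Suc n"] by (metis power_Suc)
qed

lemma indet_t_neq_indet_q_power: "indet_t \<noteq> (indet_q :: 'k::field_char_0 ratfun4) ^ n"
  unfolding indet_q_power indet_t_def to_fract_eq_iff by simp

lemma indet_t_mult_indet_q_power_neq_1: "indet_t * indet_q ^ n \<noteq> (1 :: 'k::field_char_0 ratfun4)"
  unfolding indet_q_power indet_t_def to_fract_mult[symmetric] to_fract_1[symmetric] to_fract_eq_iff
  by (simp add: one_pCons)

lemma indet_s1_neq_t_mult_s2: "indet_s1 \<noteq> (indet_t * indet_s2 :: 'k::field_char_0 ratfun4)"
  unfolding indet_s1_def indet_s2_def indet_t_def to_fract_mult[symmetric] to_fract_eq_iff
  by simp

lemma indet_q_power_mult_s1_neq_s2: "indet_q ^ n * indet_s1 \<noteq> (indet_s2 :: 'k::field_char_0 ratfun4)"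
  unfolding indet_q_power indet_s1_def indet_s2_def to_fract_mult[symmetric] to_fract_eq_iff
  by simp

theorem mainTheorem2:
  fixes q t s\<^sub>1 s\<^sub>2 :: "'k::field_char_0 ratfun4"
  assumes "q = indet_q" and "t = indet_t" and "s\<^sub>1 = indet_s1" and "s\<^sub>2 = indet_s2"
  shows "(1 - fps_X) * Abs_fps (\<lambda>\<theta>. c2 \<theta> s\<^sub>1 s\<^sub>2 q t) =
           Abs_fps (\<lambda>\<theta>. t ^ \<theta> * (qpoch (inverse t) q \<theta> / qpoch q q \<theta>)
             * (qpoch (inverse t * s\<^sub>1 / s\<^sub>2) q \<theta> / qpoch (q * s\<^sub>1 / s\<^sub>2) q \<theta>)
             * ((1 - q ^ (2 * \<theta>) * inverse t * s\<^sub>1 / s\<^sub>2) / (1 - inverse t * s\<^sub>1 / s\<^sub>2)))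
       \<and> (\<forall>l\<^sub>1 l\<^sub>2 :: nat. l\<^sub>1 \<ge> l\<^sub>2 \<longrightarrow>
           Abs_fps (\<lambda>\<theta>. LS q t \<theta> (q ^ (l\<^sub>1 - l\<^sub>2))) =
           (1 - fps_X) * Abs_fps (\<lambda>\<theta>. c2 \<theta> (t * q ^ l\<^sub>1) (q ^ l\<^sub>2) q t))"
proof (intro conjI allI impI)
  have s2: "s\<^sub>2 \<noteq> 0" and t: "t \<noteq> 0" and q0: "q \<noteq> 0" and q: "q * q ^ k \<noteq> 1" for k
    unfolding assms by (rule indet_s2_neq_0 indet_t_neq_0 indet_q_neq_0 indet_q_power_neq_1)+
  {
    have "s\<^sub>1 / s\<^sub>2 \<noteq> t"
      using s2 indet_s1_neq_t_mult_s2[where ?'k = 'k] by (simp add: assms field_simps)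
    \<comment> \<open>The leading \<open>q\<close> raises the exponent to \<open>Suc k\<close>;
      clearing \<open>s\<^sub>2\<close> leaves a comparison of polynomials.\<close>
    moreover have "q * (s\<^sub>1 / s\<^sub>2) * q ^ k \<noteq> 1" for k
      using s2 indet_q_power_mult_s1_neq_s2[where ?'k = 'k, of "Suc k"]
      by (simp add: assms field_simps)
    ultimately show "(1 - fps_X) * Abs_fps (\<lambda>\<theta>. c2 \<theta> s\<^sub>1 s\<^sub>2 q t) =
           Abs_fps (\<lambda>\<theta>. t ^ \<theta> * (qpoch (inverse t) q \<theta> / qpoch q q \<theta>)
             * (qpoch (inverse t * s\<^sub>1 / s\<^sub>2) q \<theta> / qpoch (q * s\<^sub>1 / s\<^sub>2) q \<theta>)
             * ((1 - q ^ (2 * \<theta>) * inverse t * s\<^sub>1 / s\<^sub>2) / (1 - inverse t * s\<^sub>1 / s\<^sub>2)))"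
      using one_minus_X_mult_c2_series[OF refl t] q by blast
  next
    fix l\<^sub>1 l\<^sub>2 :: nat
    assume le: "l\<^sub>2 \<le> l\<^sub>1"
    \<comment> \<open>This is \<open>w = t * a\<close> with
      \<open>a = q ^ (l\<^sub>1 - l\<^sub>2)\<close>; the natural-number subtraction is exact
      because the pair is a partition.\<close>
    have "t * q ^ l\<^sub>1 / q ^ l\<^sub>2 = t * q ^ (l\<^sub>1 - l\<^sub>2)"
      using le q0 by (simp add: power_diff)
    moreover have "t \<noteq> q ^ n" for n
      unfolding assms by (rule indet_t_neq_indet_q_power)
    moreover have "q * t * q ^ (l\<^sub>1 - l\<^sub>2) * q ^ k \<noteq> 1" for k
      using indet_t_mult_indet_q_power_neq_1[where ?'k = 'k, of "Suc (l\<^sub>1 - l\<^sub>2 + k)"]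
      by (simp add: assms power_add mult_ac)
    ultimately show "Abs_fps (\<lambda>\<theta>. LS q t \<theta> (q ^ (l\<^sub>1 - l\<^sub>2))) =
        (1 - fps_X) * Abs_fps (\<lambda>\<theta>. c2 \<theta> (t * q ^ l\<^sub>1) (q ^ l\<^sub>2) q t)"
      using LS_series_eq t q by blast
  }
qed

end
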